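(* Let $G$ be a group with identity element $e$ and let $\mathcal{A}: G \rightarrow G$ be an averaging operator on $G$, i.e. a map satisfying $\mathcal{A}(g)\mathcal{A}(h)\mathcal{A}(g)^{-1} = \mathcal{A}(\mathcal{A}(g) h \mathcal{A}(g)^{-1})$ for all $g,h\in G$. (i) Then $(G, \diamond_{\mathcal{A}})$ is a rack, where $g \diamond_{\mathcal{A}} h := \mathcal{A}(g) h \mathcal{A}(g)^{-1}$ for $g,h\in G$. If $\mathcal{A}$ is a pointed averaging operator (i.e. $\mathcal{A}(e)=e$), then the rack $(G,\diamond_{\mathcal{A}})$ is also pointed (with distinguished element $e$). (ii) The map $\mathcal{A}: G\rightarrow G$ is a homomorphism of racks from $(G,\diamond_{\mathcal{A}})$ to the conjugation rack $(G,\diamond)$, $g\diamond h = ghg^{-1}$.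
   Context: A (left) rack $(Q,\diamond)$ is a nonempty set $Q$ with a binary operation $\diamond$ such that $x\diamond(y\diamond z) = (x\diamond y)\diamond(x\diamond z)$ for all $x,y,z\in Q$, and for any $x,y\in Q$ there is a unique $c\in Q$ with $x\diamond c = y$. A rack is pointed if there is a distinguished element $e\in Q$ such that $x\diamond e = e$ and $e\diamond x = x$ for all $x\in Q$. A rack homomorphism $\varphi:(Q,\diamond)\to(Q',\diamond')$ is a map with $\varphi(x\diamond y)=\varphi(x)\diamond'\varphi(y)$ for all $x,y \in Q$. *)

theory Defs
  imports "HOL-Algebra.Group"
begin

text \<open>Racks are left racks, given by a carrier set and an operation that only matters on it.\<close>

locale rack =
  fixes Q :: "'a set" and rop :: "'a \<Rightarrow> 'a \<Rightarrow> 'a"  (infixl \<open>\<diamond>\<close> 70)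
  assumes nonempty: "Q \<noteq> {}"
    and closed: "\<lbrakk>x \<in> Q; y \<in> Q\<rbrakk> \<Longrightarrow> x \<diamond> y \<in> Q"
    and self_distributive:
      "\<lbrakk>x \<in> Q; y \<in> Q; z \<in> Q\<rbrakk> \<Longrightarrow> x \<diamond> (y \<diamond> z) = (x \<diamond> y) \<diamond> (x \<diamond> z)"
    and unique_left_division: "\<lbrakk>x \<in> Q; y \<in> Q\<rbrakk> \<Longrightarrow> \<exists>!c. c \<in> Q \<and> x \<diamond> c = y"

locale pointed_rack = rack +
  fixes e :: 'a
  assumes point_closed: "e \<in> Q"
    and right_point: "x \<in> Q \<Longrightarrow> x \<diamond> e = e"
    and left_point: "x \<in> Q \<Longrightarrow> e \<diamond> x = x"

locale rack_hom = source: rack Q rop + target: rack Q' rop'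
  for Q :: "'a set" and rop :: "'a \<Rightarrow> 'a \<Rightarrow> 'a"
    and Q' :: "'b set" and rop' :: "'b \<Rightarrow> 'b \<Rightarrow> 'b" +
  fixes \<phi> :: "'a \<Rightarrow> 'b"
  assumes hom_closed: "\<phi> \<in> Q \<rightarrow> Q'"
    and hom_op: "\<lbrakk>x \<in> Q; y \<in> Q\<rbrakk> \<Longrightarrow> \<phi> (rop x y) = rop' (\<phi> x) (\<phi> y)"

locale averaging_operator = group G
  for G :: "('a, 'm) monoid_scheme" (structure) +
  fixes A :: "'a \<Rightarrow> 'a"
  assumes avg_closed: "A \<in> carrier G \<rightarrow> carrier G"
    and averaging: "\<lbrakk>g \<in> carrier G; h \<in> carrier G\<rbrakk> \<Longrightarrow>
      A g \<otimes> A h \<otimes> inv (A g) = A (A g \<otimes> h \<otimes> inv (A g))"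

locale pointed_averaging_operator = averaging_operator +
  assumes avg_one: "A \<one> = \<one>"

definition conj_op :: "('a, 'm) monoid_scheme \<Rightarrow> 'a \<Rightarrow> 'a \<Rightarrow> 'a"
  where "conj_op G g h = g \<otimes>\<^bsub>G\<^esub> h \<otimes>\<^bsub>G\<^esub> inv\<^bsub>G\<^esub> g"

definition avg_op :: "('a, 'm) monoid_scheme \<Rightarrow> ('a \<Rightarrow> 'a) \<Rightarrow> 'a \<Rightarrow> 'a \<Rightarrow> 'a"
  where "avg_op G A g h = A g \<otimes>\<^bsub>G\<^esub> h \<otimes>\<^bsub>G\<^esub> inv\<^bsub>G\<^esub> (A g)"

end

theory Submission
  imports Defs
begin

text \<open>The operation of the averaging rack is \<open>g \<diamond> h = conj (A g) h\<close>, and averaging says exactly that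
  \<open>A\<close> takes it to conjugation. Hence self-distributivity of \<open>\<diamond>\<close> at \<open>(x, y, z)\<close> is self-distributivity
  of conjugation at \<open>(A x, A y, z)\<close>.\<close>

lemma avg_op_eq_conj_op: "avg_op G A g h = conj_op G (A g) h"
  by (simp add: avg_op_def conj_op_def)

context group
begin

lemma conj_op_closed:
  assumes "x \<in> carrier G" "y \<in> carrier G"
  shows "conj_op G x y \<in> carrier G"
  using assms by (simp add: conj_op_def)

text \<open>Conjugation is a left action of \<open>G\<close> on itself. Self-distributivity and left
  division both follow from this law.\<close>

lemma conj_op_mult_left:
  assumes "x \<in> carrier G" "y \<in> carrier G" "z \<in> carrier G"
  shows "conj_op G (x \<otimes> y) z = conj_op G x (conj_op G y z)"
  using assms by (simp add: conj_op_def inv_mult_group m_assoc)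

lemma conj_op_one_left: "x \<in> carrier G \<Longrightarrow> conj_op G \<one> x = x"
  by (simp add: conj_op_def)

lemma conj_op_one_right: "x \<in> carrier G \<Longrightarrow> conj_op G x \<one> = \<one>"
  by (simp add: conj_op_def)

lemma conj_op_self_distributive:
  assumes "x \<in> carrier G" "y \<in> carrier G" "z \<in> carrier G"
  shows "conj_op G x (conj_op G y z) = conj_op G (conj_op G x y) (conj_op G x z)"
proof -
  have "conj_op G (conj_op G x y) (conj_op G x z) = conj_op G (conj_op G x y \<otimes> x) z"
    using assms by (simp add: conj_op_mult_left conj_op_closed)
  \<comment> \<open>\<open>(x \<otimes> y \<otimes> inv x) \<otimes> x\<close> collapses, so both
    sides of the claim are the action of \<open>x \<otimes> y\<close> on \<open>z\<close>.\<close>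
  also have "conj_op G x y \<otimes> x = x \<otimes> y"
    using assms by (simp add: conj_op_def m_assoc)
  finally show ?thesis
    using assms by (simp add: conj_op_mult_left)
qed

text \<open>In a group action \<open>inv x\<close> undoes \<open>x\<close>. Existence and uniqueness
  both come from merging two successive conjugations into one by \<open>x \<otimes> inv x\<close> or
  \<open>inv x \<otimes> x\<close>, that is, by \<open>\<one>\<close>.\<close>

lemma conj_op_unique_left_division:
  assumes "x \<in> carrier G" "y \<in> carrier G"
  shows "\<exists>!c. c \<in> carrier G \<and> conj_op G x c = y"
proof (rule ex1I[of _ "conj_op G (inv x) y"])
  show "conj_op G (inv x) y \<in> carrier G \<and> conj_op G x (conj_op G (inv x) y) = y"
    using assms by (simp add: conj_op_closed conj_op_one_left flip: conj_op_mult_left)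
next
  fix c assume "c \<in> carrier G \<and> conj_op G x c = y"
  then show "c = conj_op G (inv x) y"
    using assms by (auto simp: conj_op_one_left simp flip: conj_op_mult_left)
qed

lemma rack_conj_op: "rack (carrier G) (conj_op G)"
  by unfold_locales
    (auto simp: conj_op_closed conj_op_unique_left_division intro: conj_op_self_distributive)

end

context averaging_operator
begin

lemma avg_in_carrier: "g \<in> carrier G \<Longrightarrow> A g \<in> carrier G"
  using avg_closed by blast

text \<open>The averaging identity in the form of a homomorphism law; it also drives
  self-distributivity of \<open>avg_op G A\<close>.\<close>

lemma avg_avg_op:
  assumes "g \<in> carrier G" "h \<in> carrier G"
  shows "A (avg_op G A g h) = conj_op G (A g) (A h)"
  using averaging[OF assms] by (simp add: avg_op_def conj_op_def)

lemma rack_avg_op: "rack (carrier G) (avg_op G A)"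
proof
  show "carrier G \<noteq> {}"
    by blast
next
  fix x y assume "x \<in> carrier G" "y \<in> carrier G"
  then show "avg_op G A x y \<in> carrier G"
    and "\<exists>!c. c \<in> carrier G \<and> avg_op G A x c = y"
    \<comment> \<open>Left translation by \<open>x\<close> is conjugation by \<open>A x\<close>,
      hence a bijection of the carrier whatever the shape of \<open>A\<close>.\<close>
    by (simp_all add: avg_op_eq_conj_op avg_in_carrier conj_op_closed conj_op_unique_left_division)
next
  fix x y z assume xyz: "x \<in> carrier G" "y \<in> carrier G" "z \<in> carrier G"
  have "avg_op G A x (avg_op G A y z) = conj_op G (conj_op G (A x) (A y)) (conj_op G (A x) z)"
    unfolding avg_op_eq_conj_op using xyz
    by (intro conj_op_self_distributive avg_in_carrier)
  \<comment> \<open>Averaging enters here: it turns the acting element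
    \<open>conj_op G (A x) (A y)\<close> into \<open>A (avg_op G A x y)\<close>.\<close>
  also have "\<dots> = avg_op G A (avg_op G A x y) (avg_op G A x z)"
    using xyz avg_avg_op[of x y] by (simp add: avg_op_eq_conj_op)
  finally show "avg_op G A x (avg_op G A y z) = avg_op G A (avg_op G A x y) (avg_op G A x z)" .
qed

lemma rack_hom_avg_op: "rack_hom (carrier G) (avg_op G A) (carrier G) (conj_op G) A"
  by (intro rack_hom.intro rack_hom_axioms.intro rack_avg_op rack_conj_op avg_closed avg_avg_op)

end

text \<open>Every conjugation fixes \<open>\<one>\<close>, and \<open>A \<one> = \<one>\<close>
  makes left translation by \<open>\<one>\<close> the identity.\<close>

lemma (in pointed_averaging_operator) pointed_rack_avg_op:
  "pointed_rack (carrier G) (avg_op G A) \<one>"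
  by (intro pointed_rack.intro pointed_rack_axioms.intro rack_avg_op)
    (simp_all add: avg_op_eq_conj_op avg_one avg_in_carrier conj_op_one_left conj_op_one_right)

theorem proposition2p16:
  fixes G :: "('a, 'm) monoid_scheme" and A :: "'a \<Rightarrow> 'a"
  assumes "averaging_operator G A"
  shows "rack (carrier G) (avg_op G A) \<and>
    (pointed_averaging_operator G A \<longrightarrow> pointed_rack (carrier G) (avg_op G A) \<one>\<^bsub>G\<^esub>) \<and>
    rack_hom (carrier G) (avg_op G A) (carrier G) (conj_op G) A"
  using averaging_operator.rack_avg_op[OF assms] averaging_operator.rack_hom_avg_op[OF assms]
    pointed_averaging_operator.pointed_rack_avg_op[of G A]
  by blast

end
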